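(* Fix a field $K$ and assume the monomial Simon conjecture: for all integers $m,d\ge1$, every monomial ideal $J\subset T=K[x_1,\dots,x_m]$ with linear quotients such that $G(J)\subseteq G(\mathfrak n^d)$, where $\mathfrak n=(x_1,\dots,x_m)$, can be extended to $\mathfrak n^d$ by linear quotients. Let $I\subset S=K[x_1,\dots,x_n]$ be a nonzero proper monomial ideal generated in a single degree, all of whose powers $I^k$, $k\ge1$, have linear quotients. Then either $\mathrm{v}(I^k)=\alpha(I)k-1$ for all $k\gg0$, or $\mathrm{v}(I^k)=\alpha(I)k$ for all $k\gg0$.
   Context: For a monomial ideal $I$ of a polynomial ring, $G(I)$ denotes its minimal monomial generating set. $I$ has linear quotients if there is an order $u_1,\dots,u_m$ of $G(I)$ such that $(u_1,\dots,u_{j-1}):u_j$ is generated by variables for $j=2,\dots,m$. If $I\subseteq J$ are monomial ideals with $G(I)\subseteq G(J)$, then $I$ can be extended to $J$ by linear quotients if $G(J)\setminus G(I)$ can be ordered as $v_1,\dots,v_r$ such that $(I,v_1,\dots,v_{j-1}):v_j$ is generated by variables for all $j=1,\dots,r$ (vacuous if $r=0$). For a graded ideal $I\subset S=\bigoplus_d S_d$ ($\deg x_i=1$): $\mathrm{Ass}(I)$ is the set of associated primes of $S/I$, $\alpha(I)=\min\{d: I_d\neq 0\}$, and $\mathrm{v}(I)=\min\{d: \exists f\in S_d\text{ with } (I:f)\in\mathrm{Ass}(I)\}$. "For all $k\gg0$" means for all sufficiently large integers $k$. *)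

theory Defs
  imports "HOL-Algebra.Ideal_Product" "HOL-Library.Poly_Mapping"
begin

text \<open>
  A polynomial is a finitely supported map from exponent vectors to coefficients.
  The type has infinitely many variables; \<open>K[x\<^sub>1,\<dots>,x\<^sub>n]\<close> is the subring \<open>poly_ring n\<close> of the
  polynomials that only involve the variables with (zero-based) index in \<open>{..<n}\<close>. In this way
  the number of variables can be quantified over.
\<close>

type_synonym expo = "nat \<Rightarrow>\<^sub>0 nat"
type_synonym 'k mpoly = "expo \<Rightarrow>\<^sub>0 'k"

definition expos :: "nat \<Rightarrow> expo set" where
  "expos n = {t. Poly_Mapping.keys t \<subseteq> {..<n}}"

definition poly_ring :: "nat \<Rightarrow> ('k::field) mpoly ring" where
  "poly_ring n = \<lparr>carrier = {p. Poly_Mapping.keys p \<subseteq> expos n}, mult = (*), one = 1, zero = 0, add = (+)\<rparr>"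

definition monomial :: "expo \<Rightarrow> ('k::field) mpoly" where
  "monomial t = Poly_Mapping.single t 1"

definition monomials :: "nat \<Rightarrow> ('k::field) mpoly set" where
  "monomials n = monomial ` expos n"

definition var :: "nat \<Rightarrow> ('k::field) mpoly" where
  "var i = monomial (Poly_Mapping.single i 1)"

definition total_deg :: "expo \<Rightarrow> nat" where
  "total_deg t = (\<Sum>i\<in>Poly_Mapping.keys t. Poly_Mapping.lookup t i)"

text \<open>The graded component \<open>S\<^sub>d\<close>; it contains \<open>0\<close>.\<close>

definition homog :: "nat \<Rightarrow> nat \<Rightarrow> ('k::field) mpoly set" where
  "homog n d = {p \<in> carrier (poly_ring n). \<forall>t\<in>Poly_Mapping.keys p. total_deg t = d}"

definition max_ideal :: "nat \<Rightarrow> ('k::field) mpoly set" where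
  "max_ideal n = Idl\<^bsub>poly_ring n\<^esub> (var ` {..<n})"

definition ideal_power :: "nat \<Rightarrow> ('k::field) mpoly set \<Rightarrow> nat \<Rightarrow> 'k mpoly set" where
  "ideal_power n I k = I [^]\<^bsub>ideals_set (poly_ring n)\<^esub> k"

definition colon :: "nat \<Rightarrow> ('k::field) mpoly set \<Rightarrow> 'k mpoly \<Rightarrow> 'k mpoly set" where
  "colon n I f = {g \<in> carrier (poly_ring n). g * f \<in> I}"

definition monomial_ideal :: "nat \<Rightarrow> ('k::field) mpoly set \<Rightarrow> bool" where
  "monomial_ideal n I \<longleftrightarrow> (\<exists>A \<subseteq> monomials n. I = Idl\<^bsub>poly_ring n\<^esub> A)"

definition is_min_gens :: "nat \<Rightarrow> ('k::field) mpoly set \<Rightarrow> 'k mpoly set \<Rightarrow> bool" where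
  "is_min_gens n I A \<longleftrightarrow>
     A \<subseteq> monomials n \<and> Idl\<^bsub>poly_ring n\<^esub> A = I \<and> (\<forall>B \<subset> A. Idl\<^bsub>poly_ring n\<^esub> B \<noteq> I)"

text \<open>\<open>G(I)\<close>; for a monomial ideal it exists uniquely, see \<open>ex1_min_gens\<close> below.\<close>

definition min_gens :: "nat \<Rightarrow> ('k::field) mpoly set \<Rightarrow> 'k mpoly set" where
  "min_gens n I = (THE A. is_min_gens n I A)"

definition generated_in_single_degree :: "nat \<Rightarrow> ('k::field) mpoly set \<Rightarrow> bool" where
  "generated_in_single_degree n I \<longleftrightarrow> (\<exists>d. \<exists>A \<subseteq> homog n d. I = Idl\<^bsub>poly_ring n\<^esub> A)"

text \<open>The set of variables may be empty, so that \<open>0 : v = 0\<close> counts as generated by variables.\<close>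

definition generated_by_vars :: "nat \<Rightarrow> ('k::field) mpoly set \<Rightarrow> bool" where
  "generated_by_vars n I \<longleftrightarrow> (\<exists>V \<subseteq> {..<n}. I = Idl\<^bsub>poly_ring n\<^esub> (var ` V))"

text \<open>List positions are zero-based, so the first generator is exempted by \<open>0 < j\<close>.\<close>

definition linear_quotients :: "nat \<Rightarrow> ('k::field) mpoly set \<Rightarrow> bool" where
  "linear_quotients n I \<longleftrightarrow>
     (\<exists>us. distinct us \<and> set us = min_gens n I \<and>
        (\<forall>j. 0 < j \<and> j < length us \<longrightarrow>
           generated_by_vars n (colon n (Idl\<^bsub>poly_ring n\<^esub> (set (take j us))) (us ! j))))"

definition extends_by_linear_quotients ::
    "nat \<Rightarrow> ('k::field) mpoly set \<Rightarrow> 'k mpoly set \<Rightarrow> bool" where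
  "extends_by_linear_quotients n I J \<longleftrightarrow>
     (\<exists>vs. distinct vs \<and> set vs = min_gens n J - min_gens n I \<and>
        (\<forall>j < length vs.
           generated_by_vars n (colon n (Idl\<^bsub>poly_ring n\<^esub> (I \<union> set (take j vs))) (vs ! j))))"

text \<open>\<open>colon n I f\<close> is the annihilator of the residue class of \<open>f\<close> in \<open>S/I\<close>.\<close>

definition Ass :: "nat \<Rightarrow> ('k::field) mpoly set \<Rightarrow> 'k mpoly set set" where
  "Ass n I = {P. primeideal P (poly_ring n) \<and> (\<exists>f \<in> carrier (poly_ring n). P = colon n I f)}"

definition initial_degree :: "nat \<Rightarrow> ('k::field) mpoly set \<Rightarrow> nat" where
  "initial_degree n I = (LEAST d. \<not> I \<inter> homog n d \<subseteq> {0})"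

definition v_number :: "nat \<Rightarrow> ('k::field) mpoly set \<Rightarrow> nat" where
  "v_number n I = (LEAST d. \<exists>f \<in> homog n d. colon n I f \<in> Ass n I)"


lemma poly_ring_simps [simp]:
  "carrier (poly_ring n) = {p. Poly_Mapping.keys p \<subseteq> expos n}"
  "x \<otimes>\<^bsub>poly_ring n\<^esub> y = x * y" "x \<oplus>\<^bsub>poly_ring n\<^esub> y = x + y"
  "\<one>\<^bsub>poly_ring n\<^esub> = 1" "\<zero>\<^bsub>poly_ring n\<^esub> = 0"
  by (simp_all add: poly_ring_def)

lemma keys_add_expo: "Poly_Mapping.keys (s + t) = Poly_Mapping.keys s \<union> Poly_Mapping.keys (t :: expo)"
  by (auto simp: in_keys_iff lookup_add)

lemma expos_add: "s + t \<in> expos n \<longleftrightarrow> s \<in> expos n \<and> t \<in> expos n"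
  by (simp add: expos_def keys_add_expo)

lemma expos_0: "0 \<in> expos n"
  by (simp add: expos_def)

lemma keys_mult_expos:
  "Poly_Mapping.keys p \<subseteq> expos n \<Longrightarrow> Poly_Mapping.keys q \<subseteq> expos n \<Longrightarrow> Poly_Mapping.keys (p * q) \<subseteq> expos n"
  using keys_mult[of p q] by (fastforce simp: expos_add)

lemma keys_plus_expos:
  "Poly_Mapping.keys p \<subseteq> expos n \<Longrightarrow> Poly_Mapping.keys q \<subseteq> expos n \<Longrightarrow> Poly_Mapping.keys (p + q) \<subseteq> expos n"
  using keys_add[of p q] by blast

lemma keys_uminus: "Poly_Mapping.keys (- p) = Poly_Mapping.keys (p :: ('k::field) mpoly)"
  by (auto simp: in_keys_iff)

lemma poly_ring_cring: "cring (poly_ring n :: ('k::field) mpoly ring)"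
proof (rule cringI)
  show "abelian_group (poly_ring n :: 'k mpoly ring)"
  proof (rule abelian_groupI)
    fix x :: "'k mpoly" assume "x \<in> carrier (poly_ring n)"
    then show "\<exists>y\<in>carrier (poly_ring n). y \<oplus>\<^bsub>poly_ring n\<^esub> x = \<zero>\<^bsub>poly_ring n\<^esub>"
      by (intro bexI[of _ "- x"]) (simp_all add: keys_uminus)
  qed (simp_all add: keys_plus_expos add_ac)
  show "Group.comm_monoid (poly_ring n :: 'k mpoly ring)"
    by (rule comm_monoidI) (simp_all add: keys_mult_expos expos_0 mult_ac)
qed (simp add: distrib_right)

lemma monomial_divisible_ideal:
  assumes "A \<subseteq> monomials n"
  shows "ideal {p :: ('k::field) mpoly. Poly_Mapping.keys p \<subseteq> expos n \<and>
           (\<forall>t\<in>Poly_Mapping.keys p. \<exists>s u. monomial s \<in> A \<and> t = s + u)} (poly_ring n)"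
    (is "ideal ?J _")
proof -
  interpret cring "poly_ring n :: 'k mpoly ring" by (rule poly_ring_cring)
  have inv: "inv\<^bsub>add_monoid (poly_ring n)\<^esub> a = - a"
    if "Poly_Mapping.keys a \<subseteq> expos n" for a :: "'k mpoly"
    unfolding a_inv_def[symmetric]
    using that by (intro minus_equality) (simp_all add: keys_uminus)
  have mult: "x * a \<in> ?J" if "a \<in> ?J" "Poly_Mapping.keys x \<subseteq> expos n" for a x :: "'k mpoly"
  proof -
    have "\<exists>s u. monomial s \<in> A \<and> t = s + u" if "t \<in> Poly_Mapping.keys (x * a)" for t
    proof -
      obtain v w where "t = v + w" "w \<in> Poly_Mapping.keys a"
        using keys_mult[of x a] \<open>t \<in> _\<close> by blast
      moreover then obtain s u where "monomial s \<in> A" "w = s + u" using \<open>a \<in> ?J\<close> by blast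
      ultimately have "monomial s \<in> A \<and> t = s + (v + u)" by (simp add: add_ac)
      then show ?thesis by blast
    qed
    then show ?thesis using that keys_mult_expos[of x n a] by blast
  qed
  show ?thesis
  proof (rule idealI)
    show "ring (poly_ring n :: 'k mpoly ring)" by unfold_locales
    show "subgroup ?J (add_monoid (poly_ring n))"
    proof (rule subgroup.intro)
      fix x y assume "x \<in> ?J" "y \<in> ?J"
      then show "x \<otimes>\<^bsub>add_monoid (poly_ring n)\<^esub> y \<in> ?J"
        using keys_add[of x y] by (simp add: keys_plus_expos) blast
    next
      fix x assume "x \<in> ?J"
      then show "inv\<^bsub>add_monoid (poly_ring n)\<^esub> x \<in> ?J" using inv[of x] by (simp only: mem_Collect_eq keys_uminus) blast
    qed auto
    fix a x :: "'k mpoly" assume "a \<in> ?J" "x \<in> carrier (poly_ring n)"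
    then show "x \<otimes>\<^bsub>poly_ring n\<^esub> a \<in> ?J" "a \<otimes>\<^bsub>poly_ring n\<^esub> x \<in> ?J"
      using mult[of a x] by (simp_all add: mult.commute)
  qed
qed

lemma keys_monomial: "Poly_Mapping.keys (monomial t :: ('k::field) mpoly) = {t}"
  by (simp add: monomial_def)

lemma monomial_inj: "monomial s = (monomial t :: ('k::field) mpoly) \<longleftrightarrow> s = t"
  by (metis keys_monomial singleton_inject)

lemma poly_mapping_sum:
  "p = (\<Sum>t\<in>Poly_Mapping.keys p. Poly_Mapping.single t (Poly_Mapping.lookup p t))"
  by (rule poly_mapping_eqI)
     (simp add: lookup_sum lookup_single when_def in_keys_iff)

text \<open>Membership in an ideal generated by monomials is decided term by term.\<close>

lemma genideal_monomials:
  assumes A: "A \<subseteq> monomials n"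
  shows "Idl\<^bsub>poly_ring n\<^esub> A = {p :: ('k::field) mpoly. Poly_Mapping.keys p \<subseteq> expos n \<and>
           (\<forall>t\<in>Poly_Mapping.keys p. \<exists>s u. monomial s \<in> A \<and> t = s + u)}"
    (is "_ = ?J")
proof
  interpret cring "poly_ring n :: 'k mpoly ring" by (rule poly_ring_cring)
  have Ac: "A \<subseteq> carrier (poly_ring n)"
    using A by (auto simp: monomials_def keys_monomial)
  have "A \<subseteq> ?J"
  proof
    fix a assume a: "a \<in> A"
    then obtain t where t: "a = monomial t" "t \<in> expos n" using A by (auto simp: monomials_def)
    have "monomial t \<in> A \<and> t = t + 0" using a t by simp
    then show "a \<in> ?J" using t by (auto simp: keys_monomial intro: exI[of _ 0])
  qed
  then show "Idl\<^bsub>poly_ring n\<^esub> A \<subseteq> ?J"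
    using monomial_divisible_ideal[OF A] by (rule genideal_minimal[rotated])
  interpret I: ideal "Idl\<^bsub>poly_ring n\<^esub> A" "poly_ring n :: 'k mpoly ring"
    by (rule genideal_ideal[OF Ac])
  show "?J \<subseteq> Idl\<^bsub>poly_ring n\<^esub> A"
  proof
    fix p assume p: "p \<in> ?J"
    have term_in: "Poly_Mapping.single t (Poly_Mapping.lookup p t) \<in> Idl\<^bsub>poly_ring n\<^esub> A"
      if t: "t \<in> Poly_Mapping.keys p" for t
    proof -
      obtain s u where su: "monomial s \<in> A" "t = s + u" "t \<in> expos n" using p t by blast
      have "Poly_Mapping.single u (Poly_Mapping.lookup p t) \<in> carrier (poly_ring n)"
        using su by (auto simp: expos_add)
      then have "Poly_Mapping.single u (Poly_Mapping.lookup p t) * monomial s \<in> Idl\<^bsub>poly_ring n\<^esub> A"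
        using I.I_l_closed[of "monomial s"] genideal_self[OF Ac] su(1) by auto
      then show ?thesis by (simp add: monomial_def mult_single su(2) add.commute)
    qed
    have "(\<Sum>t\<in>T. Poly_Mapping.single t (Poly_Mapping.lookup p t)) \<in> Idl\<^bsub>poly_ring n\<^esub> A"
      if "finite T" "T \<subseteq> Poly_Mapping.keys p" for T
      using that
    proof (induction T)
      case empty
      then show ?case using I.zero_closed by simp
    next
      case (insert t T)
      then show ?case using I.a_closed term_in by simp
    qed
    then show "p \<in> Idl\<^bsub>poly_ring n\<^esub> A"
      by (subst poly_mapping_sum[of p]) simp
  qed
qed

lemma total_deg_add: "total_deg (s + t) = total_deg s + total_deg t"
proof -
  have eq: "total_deg r = (\<Sum>i\<in>Poly_Mapping.keys s \<union> Poly_Mapping.keys t. Poly_Mapping.lookup r i)"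
    if "Poly_Mapping.keys r \<subseteq> Poly_Mapping.keys s \<union> Poly_Mapping.keys t" for r
    unfolding total_deg_def using that
    by (intro sum.mono_neutral_left) (auto simp: in_keys_iff)
  show ?thesis
    using eq[of s] eq[of t] eq[of "s + t"] by (simp add: keys_add_expo lookup_add sum.distrib)
qed

lemma total_deg_eq_0: "total_deg t = 0 \<longleftrightarrow> t = 0"
  by (auto simp: total_deg_def in_keys_iff intro!: poly_mapping_eqI)

lemma ex1_min_gens:
  fixes I :: "('k::field) mpoly set"
  assumes "monomial_ideal n I"
  shows "\<exists>!A. is_min_gens n I A"
proof -
  obtain A0 where A0: "A0 \<subseteq> monomials n" "I = Idl\<^bsub>poly_ring n\<^esub> A0"
    using assms by (auto simp: monomial_ideal_def)
  define E where "E = {t. (monomial t :: 'k mpoly) \<in> I}"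
  define M where "M = (monomial :: _ \<Rightarrow> 'k mpoly) ` {t \<in> E. \<forall>s u. s \<in> E \<longrightarrow> t = s + u \<longrightarrow> u = 0}"
  have E_iff: "t \<in> E \<longleftrightarrow> t \<in> expos n \<and> (\<exists>s u. monomial s \<in> A \<and> t = s + u)"
    if "A \<subseteq> monomials n" "I = Idl\<^bsub>poly_ring n\<^esub> A" for A t
    using that by (simp add: E_def genideal_monomials keys_monomial)
  have Mm: "M \<subseteq> monomials n"
    using E_iff[OF A0] by (auto simp: M_def monomials_def)
  have M_sub: "M \<subseteq> A" if A: "A \<subseteq> monomials n" "I = Idl\<^bsub>poly_ring n\<^esub> A" for A
  proof
    fix x assume "x \<in> M"
    then obtain t where t: "x = monomial t" "t \<in> E" "\<And>s u. s \<in> E \<Longrightarrow> t = s + u \<Longrightarrow> u = 0"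
      by (auto simp: M_def)
    obtain s u where su: "monomial s \<in> A" "t = s + u" "t \<in> expos n"
      using E_iff[OF A, of t] t(2) by blast
    have "monomial s \<in> A \<and> s = s + 0" using su(1) by simp
    moreover have "s \<in> expos n" using su by (simp add: expos_add)
    ultimately have "s \<in> E" using E_iff[OF A, of s] by blast
    then have "u = 0" using t(3) su(2) by blast
    then show "x \<in> A" using t(1) su by simp
  qed
  have below: "\<exists>s u. monomial s \<in> M \<and> t = s + u" if "t \<in> E" for t
    using that
  proof (induction "total_deg t" arbitrary: t rule: less_induct)
    case less
    show ?case
    proof (cases "\<forall>s u. s \<in> E \<longrightarrow> t = s + u \<longrightarrow> u = 0")
      case True
      then have "monomial t \<in> M \<and> t = t + 0" using less.prems by (simp add: M_def)
      then show ?thesis by blast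
    next
      case False
      then obtain s u where su: "s \<in> E" "t = s + u" "u \<noteq> 0" by blast
      then have "total_deg s < total_deg t"
        using total_deg_eq_0[of u] by (simp add: total_deg_add)
      then obtain s' u' where "monomial s' \<in> M" "s = s' + u'" using less.hyps su(1) by blast
      then have "monomial s' \<in> M \<and> t = s' + (u' + u)" using su(2) by (simp add: add_ac)
      then show ?thesis by blast
    qed
  qed
  have M_gen: "Idl\<^bsub>poly_ring n\<^esub> M = I"
  proof -
    have "(\<exists>s u. monomial s \<in> M \<and> t = s + u) \<longleftrightarrow> (\<exists>s u. monomial s \<in> A0 \<and> t = s + u)"
      if "t \<in> expos n" for t
      using below[of t] E_iff[OF A0, of t] M_sub[OF A0] that by blast
    then show ?thesis
      unfolding A0(2) genideal_monomials[OF Mm] genideal_monomials[OF A0(1)] by blast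
  qed
  show ?thesis
  proof (rule ex1I)
    show "is_min_gens n I M"
      unfolding is_min_gens_def using Mm M_gen M_sub by blast
    fix A assume "is_min_gens n I A"
    then show "A = M"
      unfolding is_min_gens_def using M_gen M_sub[of A] by blast
  qed
qed

end

theory Submission
  imports Defs "HOL-Library.Multiset" "HOL.Topological_Spaces" "HOL-Library.Infinite_Set"
begin

text \<open>
  Let \<open>I\<close> be minimally generated by the monomials with exponents in \<open>G\<close>, all of degree \<open>d\<close>, so that
  \<open>I\<^sup>k\<close> is generated by the \<open>k\<close>-fold sums of exponents in \<open>G\<close>, all of degree \<open>dk\<close>. A prime ideal
  of the form \<open>I\<^sup>k : f\<close> contains a nonzero monomial, hence a variable, so \<open>f\<close> has degree at least
  \<open>dk - 1\<close>. In the other direction, the conjecture extends \<open>I\<^sup>k\<close> to the power \<open>dk\<close> of the maximal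
  ideal. If something has to be added, then the first added monomial \<open>v\<close>, of degree \<open>dk\<close>, has a colon
  ideal generated by variables, which is prime; if nothing has to be added, every monomial of degree
  \<open>dk - 1\<close> has the maximal ideal as its colon ideal. Hence \<open>v(I\<^sup>k)\<close> is \<open>dk - 1\<close> or \<open>dk\<close> for every
  \<open>k \<ge> 1\<close> (\<open>extension_prime_witness\<close>).

  It remains to see that the value \<open>dk - 1\<close> propagates from \<open>k\<close> to \<open>k + 1\<close> once \<open>k\<close> is large. A prime
  colon ideal \<open>I\<^sup>k : f\<close> with \<open>f\<close> homogeneous can be witnessed by a monomial in the support of \<open>f\<close>
  (\<open>prime_colon_imp_witness\<close>), and \<open>I\<^sup>k : x\<^sup>u\<close> is the ideal generated by the variables in \<open>V\<close> iff it
  contains these variables and \<open>x\<^sup>u\<close> stays outside \<open>I\<^sup>k\<close> after setting the variables outside \<open>V\<close> to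
  \<open>1\<close>. Multiplying \<open>x\<^sup>u\<close> by a generator \<open>x\<^sup>g\<close> of \<open>I\<close> raises the degree by \<open>d\<close> and keeps the first
  property for \<open>I\<^sup>k\<^sup>+\<^sup>1\<close>. It keeps the second one for a suitable \<open>g\<close>, because
  \<open>(I\<^sub>V\<^sup>k\<^sup>+\<^sup>1 : I\<^sub>V) = I\<^sub>V\<^sup>k\<close> for large \<open>k\<close>, where \<open>I\<^sub>V\<close> is the image of \<open>I\<close> after the substitution. This
  is Ratliff's theorem for monomial ideals, proved in \<open>eventually_colon_power\<close> by Dickson's lemma on
  exponent vectors.
\<close>


section \<open>Ideals generated by monomials\<close>

text \<open>The exponents divisible by a member of \<open>T\<close>. The number of variables is not bounded here, so
  that intersections with \<open>expos n\<close> appear separately.\<close>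

definition upset :: "expo set \<Rightarrow> expo set" where
  "upset T = {s + u | s u. s \<in> T}"

text \<open>The ideal of \<open>K[x\<^sub>1,\<dots>,x\<^sub>n]\<close> generated by the monomials with exponents in \<open>T\<close>.\<close>

abbreviation mideal :: "nat \<Rightarrow> expo set \<Rightarrow> ('k::field) mpoly set" where
  "mideal n T \<equiv> Idl\<^bsub>poly_ring n\<^esub> (monomial ` T)"

lemma upset_iff: "t \<in> upset T \<longleftrightarrow> (\<exists>s\<in>T. \<exists>u. t = s + u)"
  by (auto simp: upset_def)

lemma upset_add: "t \<in> upset T \<Longrightarrow> t + w \<in> upset T"
  by (auto simp: upset_iff) (metis add.assoc)

lemma upset_self: "t \<in> T \<Longrightarrow> t \<in> upset T"
  unfolding upset_iff by (metis add.right_neutral)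

lemma monomial_image_iff: "(monomial s :: ('k::field) mpoly) \<in> monomial ` T \<longleftrightarrow> s \<in> T"
  by (auto simp: monomial_inj)

lemma mem_mideal:
  fixes p :: "('k::field) mpoly"
  assumes "T \<subseteq> expos n"
  shows "p \<in> mideal n T \<longleftrightarrow> Poly_Mapping.keys p \<subseteq> expos n \<and> Poly_Mapping.keys p \<subseteq> upset T"
proof -
  have "monomial ` T \<subseteq> (monomials n :: 'k mpoly set)"
    using assms by (auto simp: monomials_def)
  then show ?thesis
    unfolding genideal_monomials[OF \<open>monomial ` T \<subseteq> _\<close>] monomial_image_iff upset_def by blast
qed

lemma monomial_in_mideal:
  assumes "T \<subseteq> expos n" "t \<in> expos n"
  shows "(monomial t :: ('k::field) mpoly) \<in> mideal n T \<longleftrightarrow> t \<in> upset T"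
  using assms by (simp add: mem_mideal keys_monomial)

lemma mideal_ideal:
  assumes "T \<subseteq> expos n"
  shows "ideal (mideal n T :: ('k::field) mpoly set) (poly_ring n)"
proof -
  interpret cring "poly_ring n :: 'k mpoly ring" by (rule poly_ring_cring)
  show ?thesis using assms by (intro genideal_ideal) (auto simp: keys_monomial)
qed

lemma genideal_of_ideal:
  assumes "ideal I (poly_ring n :: ('k::field) mpoly ring)"
  shows "Idl\<^bsub>poly_ring n\<^esub> I = I"
proof -
  interpret cring "poly_ring n :: 'k mpoly ring" by (rule poly_ring_cring)
  interpret I: ideal I "poly_ring n :: 'k mpoly ring" by fact
  show ?thesis
    using genideal_minimal[OF assms order_refl] genideal_self[OF I.a_subset] by auto
qed

lemma monomial_mult: "monomial s * monomial t = (monomial (s + t) :: ('k::field) mpoly)"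
  by (simp add: monomial_def mult_single)

lemma keys_times_monomial:
  "Poly_Mapping.keys (p * monomial u :: ('k::field) mpoly) = (\<lambda>t. t + u) ` Poly_Mapping.keys p"
proof -
  have eq: "p * monomial u = (\<Sum>t\<in>Poly_Mapping.keys p. Poly_Mapping.single (t + u) (Poly_Mapping.lookup p t))"
    by (subst poly_mapping_sum[of p]) (simp add: sum_distrib_right monomial_def mult_single)
  have "Poly_Mapping.lookup (p * monomial u) (s + u) = Poly_Mapping.lookup p s" for s
    unfolding eq by (simp add: lookup_sum lookup_single when_def in_keys_iff)
  moreover have "Poly_Mapping.keys (p * monomial u) \<subseteq> (\<lambda>t. t + u) ` Poly_Mapping.keys p"
    using keys_mult[of p "monomial u"] by (auto simp: keys_monomial)
  ultimately show ?thesis by (auto simp: in_keys_iff)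
qed

section \<open>Powers of a monomial ideal\<close>

lemma ideal_prod_mideal:
  assumes "S \<subseteq> expos n" "T \<subseteq> expos n"
  shows "ideal_prod (poly_ring n) (mideal n S) (mideal n T) =
    (mideal n {s + t | s t. s \<in> S \<and> t \<in> T} :: ('k::field) mpoly set)" (is "?L = mideal n ?ST")
proof
  interpret cring "poly_ring n :: 'k mpoly ring" by (rule poly_ring_cring)
  have ST: "?ST \<subseteq> expos n" using assms by (auto simp: expos_add)
  interpret J: ideal "mideal n ?ST :: 'k mpoly set" "poly_ring n" by (rule mideal_ideal[OF ST])
  show "?L \<subseteq> mideal n ?ST"
  proof
    fix p assume "p \<in> ?L"
    then show "p \<in> mideal n ?ST"
    proof induction
      case (prod p q)
      have "t \<in> upset ?ST" if "t \<in> Poly_Mapping.keys (p * q)" for t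
      proof -
        obtain v w where vw: "t = v + w" "v \<in> Poly_Mapping.keys p" "w \<in> Poly_Mapping.keys q"
          using keys_mult[of p q] \<open>t \<in> _\<close> by blast
        then have "v \<in> upset S" "w \<in> upset T"
          using prod by (auto simp: mem_mideal assms)
        then obtain s s' t' u where "s \<in> S" "v = s + s'" "t' \<in> T" "w = t' + u"
          by (auto simp: upset_iff)
        then have "s + t' \<in> ?ST" "t = (s + t') + (s' + u)" using vw by (auto simp: add_ac)
        then show ?thesis unfolding upset_iff by blast
      qed
      then show ?case
        using prod keys_mult_expos[of p n q] by (auto simp: mem_mideal[OF ST] mem_mideal assms)
    next
      case (sum p q)
      then show ?case using J.a_closed by simp
    qed
  qed
  have "monomial ` ?ST \<subseteq> ?L"
  proof
    fix x :: "'k mpoly" assume "x \<in> monomial ` ?ST"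
    then obtain s t where st: "x = monomial s * monomial t" "s \<in> S" "t \<in> T"
      by (auto simp: monomial_mult)
    have "monomial s \<in> (mideal n S :: 'k mpoly set)" "monomial t \<in> (mideal n T :: 'k mpoly set)"
      using st assms by (auto simp: monomial_in_mideal subset_iff intro: upset_self)
    then show "x \<in> ?L" using ideal_prod.prod[of "monomial s :: 'k mpoly" _ "monomial t" _ "poly_ring n"] st by simp
  qed
  then show "mideal n ?ST \<subseteq> ?L"
    by (intro genideal_minimal ideal_prod_is_ideal mideal_ideal assms)
qed

text \<open>The sums of \<open>k\<close> members of \<open>G\<close> with repetition, that is, the exponents of the \<open>k\<close>-fold products
  of generators. Multisets are used so that the factors shared by two products can be cancelled.\<close>

definition msums :: "expo set \<Rightarrow> nat \<Rightarrow> expo set" where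
  "msums G k = {sum_mset M | M. set_mset M \<subseteq> G \<and> size M = k}"

lemma msums_0: "msums G 0 = {0}"
  by (auto simp: msums_def)

lemma msums_Suc: "msums G (Suc k) = {s + t | s t. s \<in> msums G k \<and> t \<in> G}"
proof (intro equalityI subsetI)
  fix x assume "x \<in> msums G (Suc k)"
  then obtain M where M: "x = sum_mset M" "set_mset M \<subseteq> G" "size M = Suc k" by (auto simp: msums_def)
  then obtain g N where "M = add_mset g N" by (metis size_eq_Suc_imp_eq_union)
  then have "x = sum_mset N + g" "sum_mset N \<in> msums G k" "g \<in> G"
    using M by (auto simp: msums_def add.commute)
  then show "x \<in> {s + t | s t. s \<in> msums G k \<and> t \<in> G}" by blast
next
  fix x assume "x \<in> {s + t | s t. s \<in> msums G k \<and> t \<in> G}"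
  then obtain M t where M: "x = sum_mset M + t" "set_mset M \<subseteq> G" "size M = k" "t \<in> G"
    by (auto simp: msums_def)
  then have "x = sum_mset (add_mset t M)" "set_mset (add_mset t M) \<subseteq> G" "size (add_mset t M) = Suc k"
    by (auto simp: add.commute)
  then show "x \<in> msums G (Suc k)" unfolding msums_def by blast
qed

lemma msums_expos: "G \<subseteq> expos n \<Longrightarrow> msums G k \<subseteq> expos n"
  by (induction k) (auto simp: msums_0 msums_Suc expos_0 expos_add)

lemma total_deg_0: "total_deg 0 = 0" by (simp add: total_deg_eq_0)

lemma msums_deg:
  assumes "\<And>g. g \<in> G \<Longrightarrow> total_deg g = d" shows "s \<in> msums G k \<Longrightarrow> total_deg s = d * k"
proof (induction k arbitrary: s)
  case 0
  then show ?case by (simp add: msums_0 total_deg_0)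
next
  case (Suc k)
  then show ?case using assms by (auto simp: msums_Suc total_deg_add)
qed

lemma ideal_power_mideal:
  assumes "G \<subseteq> expos n"
  shows "ideal_power n (mideal n G) k = (mideal n (msums G k) :: ('k::field) mpoly set)"
proof (induction k)
  case 0
  interpret cring "poly_ring n :: 'k mpoly ring" by (rule poly_ring_cring)
  have "p \<in> (mideal n {0} :: 'k mpoly set) \<longleftrightarrow> Poly_Mapping.keys p \<subseteq> expos n" for p
    using mem_mideal[of "{0}" n p] by (auto simp: expos_0 upset_iff)
  then show ?case unfolding ideal_power_def ideals_set_def msums_0 by auto
next
  case (Suc k)
  have "ideal_power n (mideal n G) (Suc k) =
    ideal_prod (poly_ring n) (ideal_power n (mideal n G) k) (mideal n G :: 'k mpoly set)"
    by (simp add: ideal_power_def ideals_set_def)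
  then show ?case
    using Suc by (simp add: ideal_prod_mideal assms msums_expos msums_Suc)
qed

text \<open>The exponent vector of a single variable.\<close>

definition xvar :: "nat \<Rightarrow> expo" where
  "xvar i = Poly_Mapping.single i 1"

lemma keys_xvar [simp]: "Poly_Mapping.keys (xvar i) = {i}"
  by (simp add: xvar_def)

lemma total_deg_xvar: "total_deg (xvar i) = 1"
  by (simp add: total_deg_def xvar_def)

lemma var_eq_monomial: "var i = monomial (xvar i)"
  by (simp add: var_def xvar_def)

lemma xvar_dvd:
  assumes "i \<in> Poly_Mapping.keys (t :: expo)"
  obtains u where "t = xvar i + u"
proof
  show "t = xvar i + (t - xvar i)"
    using assms by (intro poly_mapping_eqI)
      (auto simp: xvar_def lookup_add minus_poly_mapping.rep_eq lookup_single when_def in_keys_iff)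
qed

lemma xvar_expos: "xvar i \<in> expos n \<longleftrightarrow> i < n"
  by (simp add: expos_def)

lemma msums_vars: "msums (xvar ` {..<n}) d = {t \<in> expos n. total_deg t = d}"
proof (induction d)
  case 0
  then show ?case by (auto simp: msums_0 total_deg_eq_0 expos_0)
next
  case (Suc d)
  show ?case
  proof (intro equalityI subsetI)
    fix x assume "x \<in> msums (xvar ` {..<n}) (Suc d)"
    then show "x \<in> {t \<in> expos n. total_deg t = Suc d}"
      by (auto simp: msums_Suc Suc total_deg_add total_deg_xvar expos_add xvar_expos)
  next
    fix x assume x: "x \<in> {t \<in> expos n. total_deg t = Suc d}"
    then have "x \<noteq> 0" using total_deg_0 by auto
    then obtain i where i: "i \<in> Poly_Mapping.keys x" by (metis keys_eq_empty ex_in_conv)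
    then obtain u where u: "x = xvar i + u" by (rule xvar_dvd)
    have "i < n" using i x by (auto simp: expos_def)
    moreover have "u \<in> expos n" "total_deg u = d"
      using x u by (auto simp: expos_add total_deg_add total_deg_xvar)
    ultimately show "x \<in> msums (xvar ` {..<n}) (Suc d)"
      unfolding msums_Suc Suc u by (auto simp: add.commute)
  qed
qed

section \<open>Monomial ideals generated in one degree\<close>

lemma is_min_gens_equigenerated:
  assumes "T \<subseteq> expos n" "\<And>t. t \<in> T \<Longrightarrow> total_deg t = D"
  shows "is_min_gens n (mideal n T) (monomial ` T :: ('k::field) mpoly set)"
  unfolding is_min_gens_def
proof (intro conjI allI impI)
  show "monomial ` T \<subseteq> (monomials n :: 'k mpoly set)" using assms by (auto simp: monomials_def)
  fix B :: "'k mpoly set" assume B: "B \<subset> monomial ` T"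
  define S where "S = {t \<in> T. (monomial t :: 'k mpoly) \<in> B}"
  have BS: "B = monomial ` S" using B by (auto simp: S_def)
  obtain t where t: "t \<in> T" "(monomial t :: 'k mpoly) \<notin> B" using B by blast
  have "t \<notin> upset S"
  proof
    assume "t \<in> upset S"
    then obtain s u where su: "s \<in> S" "t = s + u" by (auto simp: upset_iff)
    then have "total_deg u = 0"
      using assms(2)[of s] assms(2)[of t] t by (auto simp: S_def total_deg_add)
    then have "t = s" using su by (simp add: total_deg_eq_0)
    then show False using su t by (simp add: S_def)
  qed
  moreover have "S \<subseteq> expos n" using assms by (auto simp: S_def)
  ultimately have "(monomial t :: 'k mpoly) \<notin> Idl\<^bsub>poly_ring n\<^esub> B"
    unfolding BS using assms t by (subst monomial_in_mideal) auto
  moreover have "(monomial t :: 'k mpoly) \<in> mideal n T"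
    using assms t by (subst monomial_in_mideal) (auto intro: upset_self)
  ultimately show "Idl\<^bsub>poly_ring n\<^esub> B \<noteq> mideal n T" by metis
qed simp

lemma mideal_monomial_ideal: "T \<subseteq> expos n \<Longrightarrow> monomial_ideal n (mideal n T :: ('k::field) mpoly set)"
  by (auto simp: monomial_ideal_def monomials_def intro!: exI[of _ "monomial ` T"])

lemma min_gens_equigenerated:
  assumes "T \<subseteq> expos n" "\<And>t. t \<in> T \<Longrightarrow> total_deg t = D"
  shows "min_gens n (mideal n T) = (monomial ` T :: ('k::field) mpoly set)"
  unfolding min_gens_def
  using is_min_gens_equigenerated[OF assms] ex1_min_gens[OF mideal_monomial_ideal[OF assms(1)]]
  by (rule the1_equality[rotated])

text \<open>The homogeneous generators need not be monomials; the monomials of degree \<open>d\<close> in the ideal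
  generate it as well, because the ideal contains every monomial in the support of its members.\<close>

lemma equigenerated_exponents:
  fixes I :: "('k::field) mpoly set"
  assumes "monomial_ideal n I" "generated_in_single_degree n I"
  obtains G d where "G \<subseteq> expos n" "\<And>g. g \<in> G \<Longrightarrow> total_deg g = d" "I = mideal n G"
proof -
  interpret cring "poly_ring n :: 'k mpoly ring" by (rule poly_ring_cring)
  obtain B where "B \<subseteq> monomials n" "I = Idl\<^bsub>poly_ring n\<^esub> B"
    using assms(1) by (auto simp: monomial_ideal_def)
  then obtain T where T: "T \<subseteq> expos n" "I = mideal n T"
    unfolding monomials_def by (metis subset_image_iff)
  obtain d A where A: "A \<subseteq> homog n d" "I = Idl\<^bsub>poly_ring n\<^esub> A"
    using assms(2) by (auto simp: generated_in_single_degree_def)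
  define G where "G = {t \<in> expos n. (monomial t :: 'k mpoly) \<in> I \<and> total_deg t = d}"
  have G: "G \<subseteq> expos n" by (auto simp: G_def)
  have I: "ideal I (poly_ring n)" unfolding T by (rule mideal_ideal[OF T(1)])
  have "A \<subseteq> mideal n G"
  proof
    fix a assume a: "a \<in> A"
    have "A \<subseteq> carrier (poly_ring n)" using A by (auto simp: homog_def)
    then have "A \<subseteq> I" unfolding A(2) by (rule genideal_self)
    then have "Poly_Mapping.keys a \<subseteq> expos n" "Poly_Mapping.keys a \<subseteq> upset T"
      using a mem_mideal[OF T(1), of a] unfolding T(2) by auto
    moreover have "\<forall>t\<in>Poly_Mapping.keys a. total_deg t = d" using a A by (auto simp: homog_def)
    ultimately have "Poly_Mapping.keys a \<subseteq> G"
      using monomial_in_mideal[OF T(1), where 'k = 'k] T(2) by (auto simp: G_def)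
    then show "a \<in> mideal n G"
      using G by (auto simp: mem_mideal intro: upset_self)
  qed
  then have "I \<subseteq> mideal n G" unfolding A(2) by (intro genideal_minimal mideal_ideal G)
  moreover have "mideal n G \<subseteq> I" by (intro genideal_minimal I) (auto simp: G_def)
  ultimately have "I = mideal n G" by (rule equalityI)
  moreover have "total_deg g = d" if "g \<in> G" for g using that unfolding G_def by blast
  ultimately show ?thesis using that[of G d] G by blast
qed

section \<open>Ideals generated by variables\<close>

lemma var_image: "var ` V = (monomial ` xvar ` V :: ('k::field) mpoly set)"
  by (auto simp: var_eq_monomial)

lemma upset_xvar: "t \<in> upset (xvar ` V) \<longleftrightarrow> Poly_Mapping.keys t \<inter> V \<noteq> {}"
proof
  assume "t \<in> upset (xvar ` V)"
  then show "Poly_Mapping.keys t \<inter> V \<noteq> {}" by (auto simp: upset_iff keys_add_expo)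
next
  assume "Poly_Mapping.keys t \<inter> V \<noteq> {}"
  then obtain i where "i \<in> V" "i \<in> Poly_Mapping.keys t" by auto
  then show "t \<in> upset (xvar ` V)" unfolding upset_iff by (metis imageI xvar_dvd)
qed

lemma mem_vars_ideal:
  fixes p :: "('k::field) mpoly"
  assumes "V \<subseteq> {..<n}"
  shows "p \<in> Idl\<^bsub>poly_ring n\<^esub> (var ` V) \<longleftrightarrow>
    Poly_Mapping.keys p \<subseteq> expos n \<and> (\<forall>t\<in>Poly_Mapping.keys p. Poly_Mapping.keys t \<inter> V \<noteq> {})"
proof -
  have "xvar ` V \<subseteq> expos n" using assms by (auto simp: expos_def)
  then show ?thesis
    unfolding var_image mem_mideal[OF \<open>xvar ` V \<subseteq> expos n\<close>] subset_iff[of _ "upset _"] upset_xvar by auto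
qed

text \<open>Modulo the variables in \<open>V\<close>, a polynomial is represented by its terms that avoid \<open>V\<close>; the ideal
  is prime because the product of two polynomials that avoid \<open>V\<close> avoids \<open>V\<close> and is nonzero unless a
  factor is zero.\<close>

lemma vars_ideal_prime:
  assumes V: "V \<subseteq> {..<n}"
  shows "primeideal (Idl\<^bsub>poly_ring n\<^esub> (var ` V)) (poly_ring n :: ('k::field) mpoly ring)" (is "primeideal ?P _")
proof (rule primeidealI)
  have "xvar ` V \<subseteq> expos n" using assms by (auto simp: expos_def)
  then show id: "ideal ?P (poly_ring n)" unfolding var_image by (rule mideal_ideal)
  interpret P: ideal ?P "poly_ring n :: 'k mpoly ring" by (rule id)
  show "cring (poly_ring n :: 'k mpoly ring)" by (rule poly_ring_cring)
  have "1 \<notin> ?P" by (simp add: mem_vars_ideal[OF V])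
  moreover have "(1 :: 'k mpoly) \<in> carrier (poly_ring n)" by (simp add: expos_0)
  ultimately show "carrier (poly_ring n) \<noteq> ?P" by metis
  fix p q :: "'k mpoly"
  assume pq: "p \<in> carrier (poly_ring n)" "q \<in> carrier (poly_ring n)" "p \<otimes>\<^bsub>poly_ring n\<^esub> q \<in> ?P"
  have plus: "a + b \<in> ?P" if "a \<in> ?P" "b \<in> ?P" for a b
    using additive_subgroup.a_closed[OF P.additive_subgroup_axioms that] by (simp only: poly_ring_simps)
  \<comment> \<open>the part of a polynomial whose terms avoid \<open>V\<close>\<close>
  define red where "red = (\<lambda>p :: 'k mpoly. \<Sum>t\<in>{t \<in> Poly_Mapping.keys p. Poly_Mapping.keys t \<inter> V = {}}.
    Poly_Mapping.single t (Poly_Mapping.lookup p t))"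
  have look: "Poly_Mapping.lookup (red p) t = (if Poly_Mapping.keys t \<inter> V = {} then Poly_Mapping.lookup p t else 0)" for p t
    by (auto simp: red_def lookup_sum lookup_single when_def in_keys_iff)
  have keys: "t \<in> Poly_Mapping.keys (red p) \<longleftrightarrow> t \<in> Poly_Mapping.keys p \<and> Poly_Mapping.keys t \<inter> V = {}" for p t
    by (simp add: in_keys_iff[of t "red p"] in_keys_iff[of t p] look)
  have keys_diff: "t \<in> Poly_Mapping.keys (p - red p) \<longleftrightarrow> t \<in> Poly_Mapping.keys p \<and> Poly_Mapping.keys t \<inter> V \<noteq> {}" for p t
    by (simp add: in_keys_iff[of t "p - red p"] in_keys_iff[of t p] lookup_minus look)
  have diff: "p - red p \<in> ?P" if "p \<in> carrier (poly_ring n)" for p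
    unfolding mem_vars_ideal[OF V] using that by (auto simp: keys_diff)
  have carr: "red p \<in> carrier (poly_ring n)" if "p \<in> carrier (poly_ring n)" for p
    using that by (auto simp: keys)
  define z where "z = (p - red p) * q + red p * (q - red q)"
  have "(p - red p) * q \<in> ?P"
    using P.I_r_closed[OF diff[OF pq(1)] pq(2)] by simp
  moreover have "red p * (q - red q) \<in> ?P"
    using P.I_l_closed[OF diff[OF pq(2)] carr[OF pq(1)]] by simp
  ultimately have "z \<in> ?P"
    unfolding z_def by (rule plus)
  then have "- z \<in> ?P" unfolding mem_vars_ideal[OF V] keys_uminus .
  then have "p * q + - z \<in> ?P" using plus pq(3) by (simp only: poly_ring_simps)
  moreover have "p * q + - z = red p * red q" unfolding z_def left_diff_distrib right_diff_distrib by simp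
  ultimately have in_P: "red p * red q \<in> ?P" by (simp only:)
  have "Poly_Mapping.keys (red p * red q) = {}"
  proof (rule ccontr)
    assume "Poly_Mapping.keys (red p * red q) \<noteq> {}"
    then obtain t where t: "t \<in> Poly_Mapping.keys (red p * red q)" by blast
    then obtain u v where "t = u + v" "u \<in> Poly_Mapping.keys (red p)" "v \<in> Poly_Mapping.keys (red q)"
      using keys_mult[of "red p" "red q"] by blast
    then have "Poly_Mapping.keys t \<inter> V = {}" by (auto simp: keys keys_add_expo)
    then show False using t in_P unfolding mem_vars_ideal[OF V] by blast
  qed
  then have "red p = 0 \<or> red q = 0" by simp
  then show "p \<in> ?P \<or> q \<in> ?P"
  proof
    assume "red p = 0"
    then show ?thesis using diff[OF pq(1)] by (simp only: diff_zero simp_thms)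
  next
    assume "red q = 0"
    then show ?thesis using diff[OF pq(2)] by (simp only: diff_zero simp_thms)
  qed
qed

section \<open>Prime colon ideals and the v-number\<close>

text \<open>The monomial with exponent \<open>u\<close> witnesses that the ideal generated by the variables in \<open>V\<close> is
  associated to the monomial ideal generated by \<open>T\<close>: its product with each of these variables lies in
  the ideal, and its products with monomials in the other variables do not.\<close>

definition prime_witness :: "nat \<Rightarrow> expo set \<Rightarrow> nat set \<Rightarrow> expo \<Rightarrow> bool" where
  "prime_witness n T V u \<longleftrightarrow> u \<in> expos n \<and> (\<forall>i\<in>V. u + xvar i \<in> upset T) \<and>
     (\<forall>w\<in>expos n. Poly_Mapping.keys w \<inter> V = {} \<longrightarrow> u + w \<notin> upset T)"

lemma mem_colon_monomial:
  fixes g :: "('k::field) mpoly"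
  assumes "T \<subseteq> expos n" "u \<in> expos n"
  shows "g \<in> colon n (mideal n T) (monomial u) \<longleftrightarrow>
    Poly_Mapping.keys g \<subseteq> expos n \<and> (\<forall>t\<in>Poly_Mapping.keys g. u + t \<in> upset T)"
proof -
  have "u + t \<in> expos n" if "Poly_Mapping.keys g \<subseteq> expos n" "t \<in> Poly_Mapping.keys g" for t
    using that assms(2) by (auto simp: expos_add)
  then show ?thesis
    unfolding colon_def mem_Collect_eq mem_mideal[OF assms(1)] keys_times_monomial
    by (auto simp: add.commute[of _ u])
qed

lemma colon_prime_witness:
  assumes T: "T \<subseteq> expos n" and V: "V \<subseteq> {..<n}" and u: "prime_witness n T V u"
  shows "colon n (mideal n T) (monomial u) = (Idl\<^bsub>poly_ring n\<^esub> (var ` V) :: ('k::field) mpoly set)"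
proof -
  have "u \<in> expos n" using u by (simp add: prime_witness_def)
  have "u + t \<in> upset T \<longleftrightarrow> Poly_Mapping.keys t \<inter> V \<noteq> {}" if "t \<in> expos n" for t
  proof
    assume "u + t \<in> upset T"
    then show "Poly_Mapping.keys t \<inter> V \<noteq> {}" using u that by (auto simp: prime_witness_def)
  next
    assume "Poly_Mapping.keys t \<inter> V \<noteq> {}"
    then obtain i where i: "i \<in> V" "i \<in> Poly_Mapping.keys t" by blast
    then obtain r where "t = xvar i + r" using xvar_dvd by blast
    moreover have "u + xvar i + r \<in> upset T"
      using u i(1) by (simp add: prime_witness_def upset_add)
    ultimately show "u + t \<in> upset T" by (simp add: add.assoc)
  qed
  then have "g \<in> colon n (mideal n T) (monomial u) \<longleftrightarrow> g \<in> Idl\<^bsub>poly_ring n\<^esub> (var ` V)" for g :: "'k mpoly"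
    using u unfolding mem_colon_monomial[OF T \<open>u \<in> expos n\<close>] mem_vars_ideal[OF V] by blast
  then show ?thesis by blast
qed

lemma monomial_in_prime:
  fixes P :: "('k::field) mpoly set"
  assumes "primeideal P (poly_ring n)" "monomial w \<in> P" "w \<in> expos n"
  shows "\<exists>i\<in>Poly_Mapping.keys w. var i \<in> P"
  using assms(2,3)
proof (induction "total_deg w" arbitrary: w rule: less_induct)
  case less
  interpret P: primeideal P "poly_ring n :: 'k mpoly ring" by fact
  have "w \<noteq> 0"
  proof
    assume "w = 0"
    then have "\<one>\<^bsub>poly_ring n\<^esub> \<in> P" using less.prems by (simp add: monomial_def)
    then show False using P.one_imp_carrier P.I_notcarr by blast
  qed
  then obtain i where i: "i \<in> Poly_Mapping.keys w" by (metis keys_eq_empty ex_in_conv)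
  then obtain r where r: "w = xvar i + r" by (rule xvar_dvd)
  have ir: "xvar i \<in> expos n" "r \<in> expos n" using less.prems r by (auto simp: expos_add)
  have "var i \<otimes>\<^bsub>poly_ring n\<^esub> monomial r \<in> P"
    using less.prems by (simp add: r var_eq_monomial monomial_mult)
  then consider "var i \<in> P" | "monomial r \<in> P"
    using P.I_prime[of "var i" "monomial r"] ir by (auto simp: var_eq_monomial keys_monomial)
  then show ?case
  proof cases
    case 1
    then show ?thesis using i by blast
  next
    case 2
    have "total_deg r < total_deg w" by (simp add: r total_deg_add total_deg_xvar)
    then have "\<exists>i\<in>Poly_Mapping.keys r. var i \<in> P" using less.hyps 2 ir by blast
    then show ?thesis by (auto simp: r keys_add_expo)
  qed
qed

text \<open>Let \<open>V\<close> be the set of variables in the prime ideal \<open>P = J : f\<close>. If no monomial \<open>x\<^sup>u\<close> in the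
  support of \<open>f\<close> were a witness for \<open>V\<close>, then each one could be moved into \<open>J\<close> by a monomial \<open>x\<^sup>w\<close>
  that avoids \<open>V\<close>. The product of these monomials would lie in \<open>P\<close>, so one of its variables would lie
  in \<open>V\<close>.\<close>

lemma prime_colon_imp_witness:
  fixes f :: "('k::field) mpoly"
  assumes T: "T \<subseteq> expos n" and f: "f \<in> homog n e"
    and prime: "primeideal (colon n (mideal n T) f) (poly_ring n)"
  shows "\<exists>V u. V \<subseteq> {..<n} \<and> prime_witness n T V u \<and> total_deg u = e"
proof -
  define P where "P = colon n (mideal n T) f"
  define V where "V = {i. i < n \<and> (var i :: 'k mpoly) \<in> P}"
  have fc: "Poly_Mapping.keys f \<subseteq> expos n" using f by (simp add: homog_def)
  have mono: "monomial w \<in> P \<longleftrightarrow> (\<forall>u\<in>Poly_Mapping.keys f. u + w \<in> upset T)" if "w \<in> expos n" for w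
  proof -
    have "Poly_Mapping.keys (monomial w * f) = (\<lambda>u. u + w) ` Poly_Mapping.keys f"
      using keys_times_monomial[of f w] by (simp add: mult.commute)
    then show ?thesis
      using that fc by (auto simp: P_def colon_def keys_monomial mem_mideal[OF T] expos_add)
  qed
  have "\<exists>u\<in>Poly_Mapping.keys f. prime_witness n T V u"
  proof (rule ccontr)
    assume none: "\<not> ?thesis"
    have "\<exists>w\<in>expos n. Poly_Mapping.keys w \<inter> V = {} \<and> u + w \<in> upset T" if u: "u \<in> Poly_Mapping.keys f" for u
    proof -
      have "\<forall>i\<in>V. u + xvar i \<in> upset T"
        using u mono[of "xvar _"] by (auto simp: V_def var_eq_monomial xvar_expos)
      then show ?thesis using none u fc by (auto simp: prime_witness_def)
    qed
    then obtain W where W: "\<And>u. u \<in> Poly_Mapping.keys f \<Longrightarrow>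
        W u \<in> expos n \<and> Poly_Mapping.keys (W u) \<inter> V = {} \<and> u + W u \<in> upset T" by metis
    define w where "w = (\<Sum>u\<in>Poly_Mapping.keys f. W u)"
    have sums: "sum W U \<in> expos n \<and> Poly_Mapping.keys (sum W U) \<inter> V = {}"
      if "finite U" "U \<subseteq> Poly_Mapping.keys f" for U
      using that W by (induction U) (auto simp: expos_0 expos_add keys_add_expo)
    have w: "w \<in> expos n" "Poly_Mapping.keys w \<inter> V = {}" using sums[of "Poly_Mapping.keys f"] by (auto simp: w_def)
    have "u + w \<in> upset T" if u: "u \<in> Poly_Mapping.keys f" for u
    proof -
      have "w = W u + (\<Sum>u\<in>Poly_Mapping.keys f - {u}. W u)"
        unfolding w_def using u by (intro sum.remove) auto
      then show ?thesis using W[OF u] upset_add[of "u + W u" T] by (simp add: add.assoc)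
    qed
    then have "monomial w \<in> P" using mono w by blast
    then obtain i where "i \<in> Poly_Mapping.keys w" "var i \<in> P"
      using monomial_in_prime prime w unfolding P_def by blast
    then have "i \<in> Poly_Mapping.keys w \<inter> V" using w by (auto simp: V_def expos_def)
    then show False using w by blast
  qed
  then obtain u where "u \<in> Poly_Mapping.keys f" "prime_witness n T V u" by blast
  moreover from this have "total_deg u = e" using f by (simp add: homog_def)
  moreover have "V \<subseteq> {..<n}" by (auto simp: V_def)
  ultimately show ?thesis by blast
qed

lemma v_number_mideal:
  assumes T: "T \<subseteq> expos n"
  shows "v_number n (mideal n T :: ('k::field) mpoly set) =
    (LEAST e. \<exists>V u. V \<subseteq> {..<n} \<and> prime_witness n T V u \<and> total_deg u = e)"
proof -
  have "(\<exists>f \<in> homog n e. colon n (mideal n T) f \<in> Ass n (mideal n T :: 'k mpoly set)) \<longleftrightarrow>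
    (\<exists>V u. V \<subseteq> {..<n} \<and> prime_witness n T V u \<and> total_deg u = e)" for e
  proof
    assume "\<exists>f \<in> homog n e. colon n (mideal n T) f \<in> Ass n (mideal n T :: 'k mpoly set)"
    then show "\<exists>V u. V \<subseteq> {..<n} \<and> prime_witness n T V u \<and> total_deg u = e"
      using prime_colon_imp_witness[OF T] by (auto simp: Ass_def)
  next
    assume "\<exists>V u. V \<subseteq> {..<n} \<and> prime_witness n T V u \<and> total_deg u = e"
    then obtain V u where V: "V \<subseteq> {..<n}" "prime_witness n T V u" "total_deg u = e" by blast
    have "primeideal (colon n (mideal n T) (monomial u :: 'k mpoly)) (poly_ring n)"
      unfolding colon_prime_witness[OF T V(1,2)] by (rule vars_ideal_prime[OF V(1)])
    moreover have "(monomial u :: 'k mpoly) \<in> homog n e"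
      using V by (auto simp: homog_def keys_monomial prime_witness_def)
    ultimately show "\<exists>f \<in> homog n e. colon n (mideal n T) f \<in> Ass n (mideal n T :: 'k mpoly set)"
      unfolding Ass_def by (auto simp: homog_def)
  qed
  then show ?thesis unfolding v_number_def by simp
qed

section \<open>Bounds on the degree of a witness\<close>

lemma upset_deg_ge:
  assumes "\<And>t. t \<in> T \<Longrightarrow> total_deg t = D" "s \<in> upset T"
  shows "D \<le> total_deg s"
  using assms by (auto simp: upset_iff total_deg_add)

lemma prime_witness_deg_ge:
  assumes deg: "\<And>t. t \<in> T \<Longrightarrow> total_deg t = D" and "T \<subseteq> expos n" "T \<noteq> {}" "prime_witness n T V u"
  shows "D \<le> Suc (total_deg u)"
proof -
  obtain t where t: "t \<in> T" using assms by blast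
  then have "u + t \<in> upset T" unfolding upset_iff by (metis add.commute)
  moreover have "t \<in> expos n" using assms t by blast
  ultimately obtain i where "i \<in> V" using assms(4) unfolding prime_witness_def by blast
  then have "u + xvar i \<in> upset T" using assms by (auto simp: prime_witness_def)
  from upset_deg_ge[OF deg this] show ?thesis by (simp add: total_deg_add total_deg_xvar)
qed

lemma max_ideal_power:
  "ideal_power n (max_ideal n) D = (mideal n {t \<in> expos n. total_deg t = D} :: ('k::field) mpoly set)"
proof -
  have "xvar ` {..<n} \<subseteq> expos n" by (auto simp: xvar_expos)
  then show ?thesis unfolding max_ideal_def var_image by (simp only: ideal_power_mideal msums_vars)
qed

text \<open>Only the first step of the extension is used. It exists unless the ideal is already the power
  of the maximal ideal, in which case any monomial of degree \<open>D - 1\<close> is a witness.\<close>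

lemma extension_prime_witness:
  fixes T :: "expo set"
  assumes T: "T \<subseteq> expos n" and deg: "\<And>t. t \<in> T \<Longrightarrow> total_deg t = D" and "n \<ge> 1" "D \<ge> 1"
    and ext: "extends_by_linear_quotients n (mideal n T :: ('k::field) mpoly set) (ideal_power n (max_ideal n) D)"
  shows "\<exists>V u. V \<subseteq> {..<n} \<and> prime_witness n T V u \<and> (total_deg u = D - 1 \<or> total_deg u = D)"
proof -
  define A where "A = {t \<in> expos n. total_deg t = D}"
  have A: "A \<subseteq> expos n" "\<And>t. t \<in> A \<Longrightarrow> total_deg t = D" by (auto simp: A_def)
  have gens: "min_gens n (mideal n A) = (monomial ` A :: 'k mpoly set)"
    "min_gens n (mideal n T) = (monomial ` T :: 'k mpoly set)"
    by (rule min_gens_equigenerated; fact)+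
  obtain vs :: "'k mpoly list" where vs: "set vs = monomial ` A - monomial ` T"
    "\<And>j. j < length vs \<Longrightarrow> generated_by_vars n (colon n (Idl\<^bsub>poly_ring n\<^esub> (mideal n T \<union> set (take j vs))) (vs ! j))"
    using ext unfolding extends_by_linear_quotients_def max_ideal_power A_def[symmetric] gens by blast
  show ?thesis
  proof (cases vs)
    case Nil
    have AT: "A \<subseteq> T"
    proof
      fix t assume "t \<in> A"
      then have "(monomial t :: 'k mpoly) \<in> monomial ` T" using vs(1) Nil by auto
      then show "t \<in> T" by (simp add: monomial_image_iff)
    qed
    define u where "u = Poly_Mapping.single (0::nat) (D - 1)"
    have u: "u \<in> expos n" "total_deg u = D - 1"
      using \<open>n \<ge> 1\<close> by (auto simp: u_def expos_def total_deg_def)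
    have "u + xvar i \<in> upset T" if "i < n" for i
    proof -
      have "u + xvar i \<in> A"
        using u that \<open>D \<ge> 1\<close> by (simp add: A_def expos_add xvar_expos total_deg_add total_deg_xvar)
      then show ?thesis using AT upset_self by blast
    qed
    moreover have "u + w \<notin> upset T" if "w \<in> expos n" "Poly_Mapping.keys w \<inter> {..<n} = {}" for w
    proof
      assume "u + w \<in> upset T"
      moreover have "Poly_Mapping.keys w = {}" using that by (auto simp del: keys_eq_empty simp: expos_def)
      then have "w = 0" by simp
      ultimately have "D \<le> total_deg u" using upset_deg_ge[OF deg] by simp
      then show False using u \<open>D \<ge> 1\<close> by simp
    qed
    ultimately have "prime_witness n T {..<n} u" using u by (simp add: prime_witness_def)
    then show ?thesis using u by blast
  next
    case (Cons v vs')
    then obtain t where t: "v = monomial t" "t \<in> A" "t \<notin> T" using vs(1) by (auto simp: monomial_image_iff)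
    have "generated_by_vars n (colon n (mideal n T) v)"
      using vs(2)[of 0] Cons genideal_of_ideal[OF mideal_ideal[OF T], where 'k = 'k] by simp
    then obtain V where "V \<subseteq> {..<n}" "colon n (mideal n T) v = Idl\<^bsub>poly_ring n\<^esub> (var ` V)"
      by (auto simp: generated_by_vars_def)
    then have "primeideal (colon n (mideal n T) v) (poly_ring n)" using vars_ideal_prime by simp
    moreover have "v \<in> homog n D" using t A by (auto simp: homog_def keys_monomial)
    ultimately show ?thesis using prime_colon_imp_witness[OF T] by blast
  qed
qed

section \<open>Colon ideals of consecutive powers\<close>

text \<open>A form of Dickson's lemma: a sequence of vectors of natural numbers with finitely many
  coordinates has a subsequence that is nondecreasing in every coordinate.\<close>

lemma monotone_subsequence:
  fixes f :: "nat \<Rightarrow> 'a \<Rightarrow> nat"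
  assumes "finite F"
  shows "\<exists>r :: nat \<Rightarrow> nat. strict_mono r \<and> (\<forall>x\<in>F. \<forall>i j. i \<le> j \<longrightarrow> f (r i) x \<le> f (r j) x)"
  using assms
proof (induction F)
  case empty
  show ?case by (intro exI[of _ id]) (simp add: strict_mono_def)
next
  case (insert a F)
  then obtain r :: "nat \<Rightarrow> nat" where r: "strict_mono r" "\<And>x i j. x \<in> F \<Longrightarrow> i \<le> j \<Longrightarrow> f (r i) x \<le> f (r j) x"
    using insert.IH by blast
  obtain s where s: "strict_mono s" "monoseq (\<lambda>i. f (r (s i)) a)"
    using seq_monosub[of "\<lambda>i. f (r i) a"] by blast
  have rs: "f (r (s i)) x \<le> f (r (s j)) x" if "x \<in> F" "i \<le> j" for x i j
    using r(2) that s(1) by (simp add: strict_mono_less_eq)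
  show ?case
  proof (cases "\<forall>i j. i \<le> j \<longrightarrow> f (r (s i)) a \<le> f (r (s j)) a")
    case True
    then have "\<forall>x\<in>insert a F. \<forall>i j. i \<le> j \<longrightarrow> f ((r \<circ> s) i) x \<le> f ((r \<circ> s) j) x"
      using rs unfolding comp_def by blast
    then show ?thesis using strict_mono_o[OF r(1) s(1)] by blast
  next
    case False
    then have dec: "f (r (s j)) a \<le> f (r (s i)) a" if "i \<le> j" for i j
      using s(2) that unfolding monoseq_def by blast
    \<comment> \<open>a nonincreasing sequence of natural numbers is constant from its minimum on\<close>
    define m where "m = (LEAST m. \<exists>i. f (r (s i)) a = m)"
    have "\<exists>i. f (r (s i)) a = m" unfolding m_def by (rule LeastI_ex) blast
    then obtain N where N: "f (r (s N)) a = m" by blast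
    have const: "f (r (s i)) a = m" if "N \<le> i" for i
    proof (rule antisym)
      show "f (r (s i)) a \<le> m" using dec[OF that] N by simp
      show "m \<le> f (r (s i)) a" unfolding m_def by (rule Least_le) blast
    qed
    define q where "q = (\<lambda>i. r (s (i + N)))"
    have "strict_mono q" unfolding q_def by (intro strict_monoI strict_monoD[OF r(1)] strict_monoD[OF s(1)]) simp
    moreover have "\<forall>x\<in>insert a F. \<forall>i j. i \<le> j \<longrightarrow> f (q i) x \<le> f (q j) x"
      unfolding q_def by (auto simp: const intro: rs)
    ultimately show ?thesis by blast
  qed
qed

text \<open>The exponents of the monomials that lie in the ideal generated by \<open>T\<close> after the variables
  outside \<open>V\<close> have been set to \<open>1\<close>: only the coordinates in \<open>V\<close> are compared.\<close>

definition cone :: "nat set \<Rightarrow> expo set \<Rightarrow> expo set" where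
  "cone V T = {u. \<exists>t\<in>T. \<forall>i\<in>V. Poly_Mapping.lookup t i \<le> Poly_Mapping.lookup u i}"

lemma cone_iff:
  assumes "T \<subseteq> expos n" "u \<in> expos n"
  shows "u \<in> cone V T \<longleftrightarrow> (\<exists>w\<in>expos n. Poly_Mapping.keys w \<inter> V = {} \<and> u + w \<in> upset T)"
proof
  assume "u \<in> cone V T"
  then obtain t where t: "t \<in> T" "\<And>i. i \<in> V \<Longrightarrow> Poly_Mapping.lookup t i \<le> Poly_Mapping.lookup u i"
    by (auto simp: cone_def)
  have "u + (t - u) = t + (u - t)"
    by (intro poly_mapping_eqI) (simp add: lookup_add minus_poly_mapping.rep_eq)
  then have "u + (t - u) \<in> upset T" using t(1) by (auto simp: upset_iff)
  moreover have "Poly_Mapping.keys (t - u) \<inter> V = {}"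
    using t(2) by (auto simp: in_keys_iff minus_poly_mapping.rep_eq)
  moreover have "Poly_Mapping.keys (t - u) \<subseteq> Poly_Mapping.keys t"
    by (auto simp: in_keys_iff minus_poly_mapping.rep_eq)
  then have "t - u \<in> expos n" using t(1) assms(1) by (auto simp: expos_def)
  ultimately show "\<exists>w\<in>expos n. Poly_Mapping.keys w \<inter> V = {} \<and> u + w \<in> upset T" by blast
next
  assume "\<exists>w\<in>expos n. Poly_Mapping.keys w \<inter> V = {} \<and> u + w \<in> upset T"
  then obtain w t r where w: "Poly_Mapping.keys w \<inter> V = {}" "t \<in> T" "u + w = t + r"
    by (auto simp: upset_iff)
  have "Poly_Mapping.lookup t i \<le> Poly_Mapping.lookup u i" if "i \<in> V" for i
  proof -
    have "Poly_Mapping.lookup w i = 0" using w(1) that by (auto simp: in_keys_iff)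
    then show ?thesis
      using arg_cong[OF w(3), of "\<lambda>p. Poly_Mapping.lookup p i"] by (simp add: lookup_add)
  qed
  then show "u \<in> cone V T" using w(2) by (auto simp: cone_def)
qed

text \<open>
  With \<open>I\<^sub>V\<close> generated by \<open>G\<close> after the variables outside \<open>V\<close> have been set to \<open>1\<close>, this says
  that \<open>(I\<^sub>V\<^sup>k\<^sup>+\<^sup>1 : I\<^sub>V) \<subseteq> I\<^sub>V\<^sup>k\<close> for all large \<open>k\<close>. Suppose that it fails for infinitely many \<open>k\<close>, at
  exponents \<open>u\<^sub>k\<close>. With a fixed \<open>g\<^sub>1 \<in> G\<close>, write \<open>u\<^sub>k + g\<^sub>1\<close> on \<open>V\<close> as a sum of \<open>k + 1\<close> generators, with
  multiplicities \<open>M\<^sub>k\<close>, plus a remainder. By Dickson's lemma there are \<open>a < b\<close> such that the remainder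
  and the multiplicities for \<open>b\<close> dominate those for \<open>a\<close>. The difference of the multiplicities is a
  sum of \<open>b - a \<ge> 1\<close> generators, and \<open>u\<^sub>b\<close> is at least \<open>u\<^sub>a\<close> plus this sum on \<open>V\<close>. One generator \<open>g\<close>
  of the sum takes \<open>u\<^sub>a\<close> into \<open>I\<^sub>V\<^sup>a\<^sup>+\<^sup>1\<close> and the other \<open>b - a - 1\<close> take the result into \<open>I\<^sub>V\<^sup>b\<close>, so
  \<open>u\<^sub>b\<close> was no counterexample.
\<close>

lemma eventually_colon_power:
  assumes "finite G" "G \<noteq> {}" "finite V"
  shows "\<forall>\<^sub>F k in sequentially. \<forall>u. (\<forall>g\<in>G. u + g \<in> cone V (msums G (Suc k))) \<longrightarrow> u \<in> cone V (msums G k)"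
proof (rule ccontr)
  define bad where "bad = (\<lambda>k u. (\<forall>g\<in>G. u + g \<in> cone V (msums G (Suc k))) \<and> u \<notin> cone V (msums G k))"
  assume "\<not> ?thesis"
  moreover have "(\<forall>u. (\<forall>g\<in>G. u + g \<in> cone V (msums G (Suc k))) \<longrightarrow> u \<in> cone V (msums G k)) \<longleftrightarrow>
      \<not> (\<exists>u. bad k u)" for k
    by (auto simp: bad_def)
  ultimately have "\<exists>\<^sub>F k in sequentially. \<exists>u. bad k u"
    unfolding frequently_def by (simp only: not_False_eq_True)
  then have inf: "infinite {k. \<exists>u. bad k u}"
    by (simp add: cofinite_eq_sequentially[symmetric] frequently_cofinite)
  define kk where "kk = Infinite_Set.enumerate {k. \<exists>u. bad k u}"
  have kk: "strict_mono kk" unfolding kk_def by (rule strict_mono_enumerate[OF inf])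
  have "\<exists>u. bad (kk a) u" for a using enumerate_in_set[OF inf, of a] by (simp add: kk_def)
  then obtain uu where uu: "\<And>a. bad (kk a) (uu a)" by metis
  obtain g1 where g1: "g1 \<in> G" using assms by blast
  have "\<exists>M. set_mset M \<subseteq> G \<and> size M = Suc (kk a) \<and>
      (\<forall>i\<in>V. Poly_Mapping.lookup (sum_mset M) i \<le> Poly_Mapping.lookup (uu a + g1) i)" for a
  proof -
    have "uu a + g1 \<in> cone V (msums G (Suc (kk a)))" using uu[of a] g1 by (auto simp: bad_def)
    then show ?thesis by (auto simp: cone_def msums_def)
  qed
  then obtain MM where MM: "\<And>a. set_mset (MM a) \<subseteq> G" "\<And>a. size (MM a) = Suc (kk a)"
      "\<And>a i. i \<in> V \<Longrightarrow> Poly_Mapping.lookup (sum_mset (MM a)) i \<le> Poly_Mapping.lookup (uu a + g1) i"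
    by metis
  \<comment> \<open>remainders on \<open>V\<close> together with multiplicities on \<open>G\<close>\<close>
  define vec where "vec = (\<lambda>a. case_sum
    (\<lambda>i. Poly_Mapping.lookup (uu a + g1) i - Poly_Mapping.lookup (sum_mset (MM a)) i) (count (MM a)))"
  obtain r :: "nat \<Rightarrow> nat" where r: "strict_mono r" "\<forall>x\<in>V <+> G. \<forall>i j. i \<le> j \<longrightarrow> vec (r i) x \<le> vec (r j) x"
    using monotone_subsequence[of "V <+> G" vec] assms(1,3) finite_Plus by blast
  define a b where "a = r 0" and "b = r 1"
  have ab: "vec a x \<le> vec b x" if "x \<in> V <+> G" for x
    using r(2) that unfolding a_def b_def by blast
  have "a < b" using r(1) by (simp add: a_def b_def strict_mono_less)
  then have kab: "kk a < kk b" using kk by (simp add: strict_mono_less)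
  have "MM a \<subseteq># MM b"
  proof (rule mset_subset_eqI)
    fix g
    show "count (MM a) g \<le> count (MM b) g"
    proof (cases "g \<in> G")
      case True
      then show ?thesis using ab[of "Inr g"] by (auto simp: vec_def)
    next
      case False
      then have "g \<notin># MM a" using MM(1) by blast
      then show ?thesis by (simp add: not_in_iff)
    qed
  qed
  then obtain N where N: "MM b = MM a + N" by (metis subset_mset.add_diff_inverse)
  have "size N = kk b - kk a" using MM(2)[of a] MM(2)[of b] N by simp
  then obtain g N' where gN: "N = add_mset g N'" using kab by (cases N) auto
  have gG: "g \<in> G" "set_mset N' \<subseteq> G" using MM(1)[of b] N gN by auto
  then have "uu a + g \<in> cone V (msums G (Suc (kk a)))" using uu[of a] by (auto simp: bad_def)
  then obtain M where M: "set_mset M \<subseteq> G" "size M = Suc (kk a)"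
    "\<And>i. i \<in> V \<Longrightarrow> Poly_Mapping.lookup (sum_mset M) i \<le> Poly_Mapping.lookup (uu a + g) i"
    by (auto simp: cone_def msums_def)
  \<comment> \<open>the \<open>Suc (kk a)\<close> factors of \<open>uu a + g\<close> and the generators in \<open>N\<close> other than \<open>g\<close>\<close>
  have "size (M + N') = kk b" using M(2) MM(2)[of a] MM(2)[of b] N gN kab by simp
  then have "sum_mset (M + N') \<in> msums G (kk b)"
    unfolding msums_def using M(1) gG(2) by (intro CollectI exI[of _ "M + N'"]) auto
  moreover have "Poly_Mapping.lookup (sum_mset (M + N')) i \<le> Poly_Mapping.lookup (uu b) i" if i: "i \<in> V" for i
  proof -
    have "Poly_Mapping.lookup (uu a + g1) i - Poly_Mapping.lookup (sum_mset (MM a)) i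
       \<le> Poly_Mapping.lookup (uu b + g1) i - Poly_Mapping.lookup (sum_mset (MM b)) i"
      using ab[of "Inl i"] i by (auto simp: vec_def)
    then show ?thesis
      using M(3)[OF i] MM(3)[OF i, of a] MM(3)[OF i, of b] unfolding N gN by (simp add: lookup_add)
  qed
  ultimately have "uu b \<in> cone V (msums G (kk b))" unfolding cone_def by blast
  then show False using uu[of b] by (simp add: bad_def)
qed

section \<open>The v-number of the powers\<close>

text \<open>For large \<open>k\<close>, multiplication by a suitable generator turns a witness for \<open>I\<^sup>k\<close> into one for
  \<open>I\<^sup>k\<^sup>+\<^sup>1\<close> with the same variables. The bound on \<open>k\<close> is uniform in \<open>V\<close> because there are finitely many
  sets \<open>V\<close>.\<close>

lemma prime_witness_Suc:
  assumes G: "G \<subseteq> expos n" "finite G" "G \<noteq> {}"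
  shows "\<forall>\<^sub>F k in sequentially. \<forall>V u. V \<subseteq> {..<n} \<and> prime_witness n (msums G k) V u \<longrightarrow>
    (\<exists>g\<in>G. prime_witness n (msums G (Suc k)) V (u + g))"
proof -
  have fin: "finite V" if "V \<in> Pow {..<n}" for V :: "nat set"
    using that finite_subset by auto
  have "\<forall>\<^sub>F k in sequentially. \<forall>V\<in>Pow {..<n}. \<forall>u.
    (\<forall>g\<in>G. u + g \<in> cone V (msums G (Suc k))) \<longrightarrow> u \<in> cone V (msums G k)"
    using eventually_colon_power[OF G(2,3) fin] by (intro eventually_ball_finite) auto
  then show ?thesis
  proof (rule eventually_mono, intro allI impI)
    fix k V u
    assume colon: "\<forall>V\<in>Pow {..<n}. \<forall>u. (\<forall>g\<in>G. u + g \<in> cone V (msums G (Suc k))) \<longrightarrow> u \<in> cone V (msums G k)"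
      and "V \<subseteq> {..<n} \<and> prime_witness n (msums G k) V u"
    then have V: "V \<subseteq> {..<n}" and u: "prime_witness n (msums G k) V u" by auto
    have ue: "u \<in> expos n" using u by (simp add: prime_witness_def)
    have "u \<notin> cone V (msums G k)"
      using u by (auto simp: cone_iff[OF msums_expos[OF G(1)] ue] prime_witness_def)
    then obtain g where g: "g \<in> G" "u + g \<notin> cone V (msums G (Suc k))" using colon V by blast
    have ge: "u + g \<in> expos n" using ue g G by (auto simp: expos_add)
    have "u + g + xvar i \<in> upset (msums G (Suc k))" if "i \<in> V" for i
    proof -
      have "u + xvar i \<in> upset (msums G k)" using u that by (simp add: prime_witness_def)
      then obtain s r where "s \<in> msums G k" "u + xvar i = s + r" by (auto simp: upset_iff)
      then have "s + g \<in> msums G (Suc k)" "u + g + xvar i = (s + g) + r"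
        using g(1) unfolding msums_Suc by (blast, simp add: add_ac)
      then show ?thesis unfolding upset_iff by blast
    qed
    moreover have "\<forall>w\<in>expos n. Poly_Mapping.keys w \<inter> V = {} \<longrightarrow> u + g + w \<notin> upset (msums G (Suc k))"
      using g(2) cone_iff[OF msums_expos[OF G(1)] ge] by blast
    ultimately have "prime_witness n (msums G (Suc k)) V (u + g)" using ge by (simp add: prime_witness_def)
    then show "\<exists>g\<in>G. prime_witness n (msums G (Suc k)) V (u + g)" using g(1) by blast
  qed
qed

lemma initial_degree_mideal:
  assumes G: "G \<subseteq> expos n" "G \<noteq> {}" and deg: "\<And>g. g \<in> G \<Longrightarrow> total_deg g = d"
  shows "initial_degree n (mideal n G :: ('k::field) mpoly set) = d"
  unfolding initial_degree_def
proof (rule Least_equality)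
  obtain g where g: "g \<in> G" using G by blast
  then have "(monomial g :: 'k mpoly) \<in> mideal n G \<inter> homog n d"
    using G deg by (auto simp: mem_mideal homog_def keys_monomial intro: upset_self)
  moreover have "(monomial g :: 'k mpoly) \<noteq> 0" using keys_monomial[of g, where 'k = 'k] by auto
  ultimately show "\<not> (mideal n G :: 'k mpoly set) \<inter> homog n d \<subseteq> {0}" by blast
next
  fix e assume "\<not> (mideal n G :: 'k mpoly set) \<inter> homog n e \<subseteq> {0}"
  then obtain p :: "'k mpoly" where p: "p \<in> mideal n G" "p \<in> homog n e" "p \<noteq> 0" by blast
  then obtain t where "t \<in> Poly_Mapping.keys p" by (metis keys_eq_empty ex_in_conv)
  then have "t \<in> upset G" "total_deg t = e" using p G by (auto simp: mem_mideal homog_def)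
  then show "d \<le> e" using upset_deg_ge[OF deg] by auto
qed

lemma finite_expos_deg: "finite {t \<in> expos n. total_deg t = d}"
proof -
  have "finite (msums G k)" if "finite G" for G k
  proof (induction k)
    case 0
    then show ?case by (simp add: msums_0)
  next
    case (Suc k)
    have "msums G (Suc k) = (\<lambda>(s, t). s + t) ` (msums G k \<times> G)" by (auto simp: msums_Suc)
    then show ?case using Suc that by simp
  qed
  then show ?thesis unfolding msums_vars[symmetric] by simp
qed

lemma v_number_powers:
  fixes G :: "expo set"
  assumes G: "G \<subseteq> expos n" "G \<noteq> {}" and deg: "\<And>g. g \<in> G \<Longrightarrow> total_deg g = d" and "d \<ge> 1" "n \<ge> 1"
    and ext: "\<And>k. k \<ge> 1 \<Longrightarrow> extends_by_linear_quotients n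
      (mideal n (msums G k) :: ('k::field) mpoly set) (ideal_power n (max_ideal n) (d * k))"
  shows "(\<forall>\<^sub>F k in sequentially. v_number n (mideal n (msums G k) :: 'k mpoly set) = d * k - 1) \<or>
    (\<forall>\<^sub>F k in sequentially. v_number n (mideal n (msums G k) :: 'k mpoly set) = d * k)"
proof -
  \<comment> \<open>\<open>Q k e\<close>: some prime colon ideal of the power \<open>k\<close> is attained in degree \<open>e\<close>\<close>
  define Q where "Q = (\<lambda>k e. \<exists>V u. V \<subseteq> {..<n} \<and> prime_witness n (msums G k) V u \<and> total_deg u = e)"
  have v: "v_number n (mideal n (msums G k) :: 'k mpoly set) = (LEAST e. Q k e)" for k
    unfolding Q_def by (rule v_number_mideal[OF msums_expos[OF G(1)]])
  have ne: "msums G k \<noteq> {}" for k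
    using G(2) by (induction k) (auto simp: msums_0 msums_Suc)
  have deg_sums: "total_deg s = d * k" if "s \<in> msums G k" for s k
    using msums_deg[OF _ that] deg by blast
  have low: "d * k \<le> Suc e" if Q: "Q k e" for k e
  proof -
    obtain V u where "prime_witness n (msums G k) V u" "total_deg u = e"
      using Q unfolding Q_def by blast
    then show ?thesis
      using prime_witness_deg_ge[of "msums G k" "d * k", OF deg_sums msums_expos[OF G(1)] ne] by metis
  qed
  have up: "Q k (d * k - 1) \<or> Q k (d * k)" if "k \<ge> 1" for k
  proof -
    have "d * k \<ge> 1" using \<open>d \<ge> 1\<close> that by simp
    from extension_prime_witness[OF msums_expos[OF G(1)] deg_sums \<open>n \<ge> 1\<close> this ext[OF that]]
    show ?thesis unfolding Q_def by blast
  qed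
  have v_low: "(LEAST e. Q k e) = d * k - 1" if "Q k (d * k - 1)" for k
  proof (rule Least_equality[of "Q k", OF that])
    fix e assume "Q k e"
    from low[OF this] show "d * k - 1 \<le> e" by linarith
  qed
  have v_high: "(LEAST e. Q k e) = d * k" if "\<not> Q k (d * k - 1)" "k \<ge> 1" for k
  proof (rule Least_equality)
    show "Q k (d * k)" using up that by blast
    fix e assume e: "Q k e"
    then have "e \<noteq> d * k - 1" using that by blast
    then show "d * k \<le> e" using low[OF e] by linarith
  qed
  have "finite G" using finite_expos_deg[of n d] by (rule finite_subset[rotated]) (use G(1) deg in blast)
  have "\<forall>\<^sub>F k in sequentially. Q k (d * k - 1) \<longrightarrow> Q (Suc k) (d * Suc k - 1)"
    using prime_witness_Suc[OF G(1) \<open>finite G\<close> G(2)] eventually_ge_at_top[of 1]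
  proof eventually_elim
    case (elim k)
    have pos: "d * k \<ge> 1" using elim(2) \<open>d \<ge> 1\<close> by simp
    show ?case
    proof
      assume "Q k (d * k - 1)"
      then obtain V u where u: "V \<subseteq> {..<n}" "prime_witness n (msums G k) V u" "total_deg u = d * k - 1"
        by (auto simp: Q_def)
      then obtain g where "g \<in> G" "prime_witness n (msums G (Suc k)) V (u + g)" using elim(1) by blast
      moreover have "total_deg (u + g) = d * Suc k - 1"
        using u(3) deg[OF \<open>g \<in> G\<close>] pos by (simp add: total_deg_add)
      ultimately show "Q (Suc k) (d * Suc k - 1)" using u(1) unfolding Q_def by blast
    qed
  qed
  then obtain K where K: "\<And>k. k \<ge> K \<Longrightarrow> Q k (d * k - 1) \<Longrightarrow> Q (Suc k) (d * Suc k - 1)"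
    by (auto simp: eventually_sequentially)
  show ?thesis
  proof (cases "\<exists>k\<ge>K. Q k (d * k - 1)")
    case True
    then obtain k0 where k0: "k0 \<ge> K" "Q k0 (d * k0 - 1)" by blast
    have "Q k (d * k - 1)" if "k \<ge> k0" for k
      using that
    proof (induction k rule: dec_induct)
      case base
      show ?case by (rule k0(2))
    next
      case (step k)
      then show ?case using K[of k] k0(1) by linarith
    qed
    then show ?thesis unfolding v eventually_sequentially using v_low by blast
  next
    case False
    then have "(LEAST e. Q k e) = d * k" if "k \<ge> max K 1" for k
      using that by (intro v_high) auto
    then show ?thesis unfolding v eventually_sequentially by blast
  qed
qed

theorem corollary3p5:
  fixes n :: nat and I :: "('k::field) mpoly set"
  assumes simon: "\<And>m d (J :: 'k mpoly set).
      m \<ge> 1 \<Longrightarrow> d \<ge> 1 \<Longrightarrow> monomial_ideal m J \<Longrightarrow> linear_quotients m J \<Longrightarrow>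
      min_gens m J \<subseteq> min_gens m (ideal_power m (max_ideal m) d) \<Longrightarrow>
      extends_by_linear_quotients m J (ideal_power m (max_ideal m) d)"
    and "monomial_ideal n I"
    and "I \<noteq> {0}"
    and "I \<noteq> carrier (poly_ring n)"
    and "generated_in_single_degree n I"
    and "\<And>k. k \<ge> 1 \<Longrightarrow> linear_quotients n (ideal_power n I k)"
  shows "(\<forall>\<^sub>F k in sequentially.
            int (v_number n (ideal_power n I k)) = int (initial_degree n I) * int k - 1) \<or>
         (\<forall>\<^sub>F k in sequentially.
            v_number n (ideal_power n I k) = initial_degree n I * k)"
proof -
  obtain G d where G: "G \<subseteq> expos n" and deg: "\<And>g. g \<in> G \<Longrightarrow> total_deg g = d" and I: "I = mideal n G"
    using equigenerated_exponents[OF \<open>monomial_ideal n I\<close> \<open>generated_in_single_degree n I\<close>] by blast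
  have mem: "p \<in> I \<longleftrightarrow> Poly_Mapping.keys p \<subseteq> expos n \<and> Poly_Mapping.keys p \<subseteq> upset G" for p
    unfolding I by (rule mem_mideal[OF G])
  have "G \<noteq> {}"
  proof
    assume "G = {}"
    then have "p \<in> I \<longleftrightarrow> p = 0" for p using mem[of p] by (auto simp: upset_def)
    then show False using \<open>I \<noteq> {0}\<close> by blast
  qed
  then obtain g where g: "g \<in> G" by blast
  have "g \<noteq> 0"
  proof
    assume "g = 0"
    then have "upset G = UNIV" using g upset_add[OF upset_self[OF g]] by auto
    then have "p \<in> I \<longleftrightarrow> p \<in> carrier (poly_ring n)" for p using mem[of p] by simp
    then show False using \<open>I \<noteq> carrier (poly_ring n)\<close> by blast
  qed
  then have "d \<ge> 1" using deg[OF g] total_deg_eq_0[of g] by (cases d) auto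
  have "n \<ge> 1" using g G \<open>g \<noteq> 0\<close> by (cases n) (auto simp: expos_def)
  have power: "ideal_power n I k = mideal n (msums G k)" for k
    unfolding I by (rule ideal_power_mideal[OF G])
  have ext: "extends_by_linear_quotients n (mideal n (msums G k) :: 'k mpoly set)
      (ideal_power n (max_ideal n) (d * k))" if "k \<ge> 1" for k
  proof (rule simon)
    show "n \<ge> 1" by fact
    show "d * k \<ge> 1" using \<open>d \<ge> 1\<close> that by simp
    show "monomial_ideal n (mideal n (msums G k) :: 'k mpoly set)"
      by (rule mideal_monomial_ideal[OF msums_expos[OF G]])
    show "linear_quotients n (mideal n (msums G k) :: 'k mpoly set)"
      using assms(6)[OF that] by (simp only: power)
    have "msums G k \<subseteq> {t \<in> expos n. total_deg t = d * k}"
      using msums_expos[OF G] msums_deg[of G d] deg by auto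
    moreover have "min_gens n (mideal n (msums G k)) = (monomial ` msums G k :: 'k mpoly set)"
      using msums_expos[OF G] msums_deg[of G d] deg by (intro min_gens_equigenerated) auto
    moreover have "min_gens n (ideal_power n (max_ideal n) (d * k)) =
        (monomial ` {t \<in> expos n. total_deg t = d * k} :: 'k mpoly set)"
      unfolding max_ideal_power by (rule min_gens_equigenerated) auto
    ultimately show "min_gens n (mideal n (msums G k) :: 'k mpoly set) \<subseteq>
        min_gens n (ideal_power n (max_ideal n) (d * k))" by (simp add: image_mono)
  qed
  have init: "initial_degree n I = d" unfolding I by (rule initial_degree_mideal[OF G \<open>G \<noteq> {}\<close> deg])
  have "(\<forall>\<^sub>F k in sequentially. v_number n (mideal n (msums G k) :: 'k mpoly set) = d * k - 1) \<or>
    (\<forall>\<^sub>F k in sequentially. v_number n (mideal n (msums G k) :: 'k mpoly set) = d * k)"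
    by (rule v_number_powers[OF G \<open>G \<noteq> {}\<close> deg \<open>d \<ge> 1\<close> \<open>n \<ge> 1\<close> ext])
  then show ?thesis
  proof (elim disjE)
    assume "\<forall>\<^sub>F k in sequentially. v_number n (mideal n (msums G k) :: 'k mpoly set) = d * k - 1"
    then have "\<forall>\<^sub>F k in sequentially. int (v_number n (ideal_power n I k)) = int (initial_degree n I) * int k - 1"
      using eventually_ge_at_top[of 1]
    proof eventually_elim
      case (elim k)
      have "d * k \<ge> 1" using elim(2) \<open>d \<ge> 1\<close> by simp
      then show ?case using elim(1) by (simp add: power init of_nat_diff)
    qed
    then show ?thesis ..
  next
    assume "\<forall>\<^sub>F k in sequentially. v_number n (mideal n (msums G k) :: 'k mpoly set) = d * k"
    then show ?thesis unfolding power init ..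
  qed
qed

end
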